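(* Let $k$ be a positive integer. Then the sets of patterns $M_{k,i+1,i+1}$, for $0 \leq i \leq k$, are all Wilf-equivalent to one another; that is, for all $0 \leq i, i' \leq k$ and all positive integers $n$, $|\mathrm{Av}_n(M_{k,i+1,i+1})| = |\mathrm{Av}_n(M_{k,i'+1,i'+1})|$.
   Context: Permutations are written in one-line notation. A permutation $p=p_1\cdots p_n\in\mathfrak{S}_n$ contains $q=q_1\cdots q_m\in\mathfrak{S}_m$ if there are indices $i_1<\dots<i_m$ such that $q_a<q_b \iff p_{i_a}<p_{i_b}$ for all $a,b$; otherwise $p$ avoids $q$. For a set $Q$ of permutations, $\mathrm{Av}_n(Q)$ is the set of all $p\in\mathfrak{S}_n$ avoiding every element of $Q$. Two sets $P,Q$ of permutations are Wilf-equivalent if $|\mathrm{Av}_n(P)|=|\mathrm{Av}_n(Q)|$ for all positive integers $n$. For integers $k\ge 1$ and $1\le i,j\le k+1$, $M_{k,j,i}$ denotes the following set of $k$ permutations of length $k+1$: all $\pi\in\mathfrak{S}_{k+1}$ such that $\pi_j\neq i$ and the word obtained from $\pi_1\cdots\pi_{k+1}$ by deleting the entry $\pi_j$ in position $j$ is increasing. (Equivalently, for each value $v\in\{1,\dots,k+1\}\setminus\{i\}$, take the permutation with $v$ in position $j$ and the remaining values in increasing order in the remaining positions.) For example, $M_{3,3,2}=\{2314,1234,1243\}$. *)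

theory Defs
  imports "HOL-Combinatorics.Combinatorics"
begin

text \<open>
  A permutation in \<open>S\<^sub>n\<close> is its one-line word: a list in \<open>permutations_of_set {1..n}\<close>.
  List indexing starts at 0, so the entry in position \<open>j\<close> (\<open>1 \<le> j \<le> n\<close>) of \<open>p\<close> is \<open>p ! (j - 1)\<close>.
\<close>

definition perms :: "nat \<Rightarrow> nat list set" where
  "perms n = permutations_of_set {1..n}"

definition contains :: "nat list \<Rightarrow> nat list \<Rightarrow> bool" where
  "contains p q \<longleftrightarrow>
     (\<exists>f. strict_mono_on {..<length q} f \<and> f ` {..<length q} \<subseteq> {..<length p} \<and>
          (\<forall>a<length q. \<forall>b<length q. q ! a < q ! b \<longleftrightarrow> p ! f a < p ! f b))"

definition Av :: "nat \<Rightarrow> nat list set \<Rightarrow> nat list set" where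
  "Av n Q = {p \<in> perms n. \<forall>q\<in>Q. \<not> contains p q}"

definition wilf_equivalent :: "nat list set \<Rightarrow> nat list set \<Rightarrow> bool" where
  "wilf_equivalent P Q \<longleftrightarrow> (\<forall>n\<ge>1. card (Av n P) = card (Av n Q))"

text \<open>\<open>M k j i\<close> is meant for \<open>k \<ge> 1\<close> and \<open>1 \<le> i, j \<le> k + 1\<close>.\<close>

definition M :: "nat \<Rightarrow> nat \<Rightarrow> nat \<Rightarrow> nat list set" where
  "M k j i = {p \<in> perms (k + 1). p ! (j - 1) \<noteq> i \<and>
                                 sorted_wrt (<) (take (j - 1) p @ drop j p)}"

end

theory Submission
  imports Defs
begin

text \<open>
  A permutation contains a pattern of the \<open>i\<close>-th set iff for some increasing subsequence
  \<open>a\<^sub>1 < \<dots> < a\<^sub>k\<close> an entry positioned between \<open>a\<^sub>i\<close> and \<open>a\<^sub>i\<^sub>+\<^sub>1\<close> has a value outside the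
  interval between them. Framing \<open>p\<close> as \<open>0 p (n + 1)\<close> supplies \<open>a\<^sub>0\<close> and \<open>a\<^sub>k\<^sub>+\<^sub>1\<close>.

  Suppose \<open>i \<ge> 1\<close> and \<open>p\<close> avoids these patterns. Delete from \<open>p\<close> all entries that are the \<open>i\<close>-th
  entry of an increasing subsequence of length \<open>k\<close>. The remaining word \<open>w\<close> has no increasing
  subsequence of length \<open>k\<close> and determines \<open>p\<close>: a deleted \<open>t\<close> stands just in front of the last entry
  \<open>y > t\<close> of \<open>w\<close> that starts an increasing subsequence of length \<open>k - i\<close> (of the frame
  entry \<open>n + 1\<close> if \<open>i = k\<close>), and deleted entries with the same \<open>y\<close> stand in increasing order. The words that arise are those
  in which every missing value \<open>t\<close> can be put in the gap of an increasing subsequence of length \<open>k - 1\<close>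
  that has \<open>i - 1\<close> entries below \<open>t\<close>. Reverse complement turns these words for \<open>i\<close> into those for
  \<open>k + 1 - i\<close>, whereas it turns the permutations for \<open>i\<close> into those for \<open>k - i\<close>. Hence the cases \<open>i\<close> and
  \<open>i - 1\<close> are equinumerous.
\<close>

section \<open>Positions and increasing chains\<close>

text \<open>Relative position is kept as a relation between values because indices shift when
  entries are deleted, inserted or reversed. For distinct entries this relation and the set of
  entries determine the word.\<close>

fun before :: "'a list \<Rightarrow> 'a \<Rightarrow> 'a \<Rightarrow> bool" where
  "before [] x y \<longleftrightarrow> False"
| "before (h # q) x y \<longleftrightarrow> (h = x \<and> y \<in> set q) \<or> before q x y"

lemma before_append:
  "before (p @ q) x y \<longleftrightarrow>
    before p x y \<or> before q x y \<or> (x \<in> set p \<and> y \<in> set q)"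
  by (induction p) auto

lemma before_in_set: "before q x y \<Longrightarrow> x \<in> set q \<and> y \<in> set q"
  by (induction q) auto

lemma before_filter: "before (filter Q q) x y \<longleftrightarrow> before q x y \<and> Q x \<and> Q y"
  by (induction q) (auto dest: before_in_set)

lemma before_rev: "before (rev q) x y \<longleftrightarrow> before q y x"
  by (induction q) (auto simp: before_append)

lemma before_map_inj:
  assumes "inj_on g A" "set q \<subseteq> A" "x \<in> A" "y \<in> A"
  shows "before (map g q) (g x) (g y) \<longleftrightarrow> before q x y"
  using assms(2)
proof (induction q)
  case (Cons h q)
  have "g h = g x \<longleftrightarrow> h = x" using assms Cons.prems by (auto simp: inj_on_def)
  moreover have "g y \<in> g ` set q \<longleftrightarrow> y \<in> set q"
    using assms Cons.prems by (auto simp: inj_on_def)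
  ultimately show ?case using Cons by simp
qed simp

lemma before_trans: "distinct q \<Longrightarrow> before q x y \<Longrightarrow> before q y z \<Longrightarrow> before q x z"
  by (induction q) (auto dest: before_in_set)

lemma before_irrefl: "distinct q \<Longrightarrow> \<not> before q x x"
  by (induction q) auto

lemma before_asym: "distinct q \<Longrightarrow> before q x y \<Longrightarrow> \<not> before q y x"
  using before_trans before_irrefl by metis

lemma before_total: "x \<in> set q \<Longrightarrow> y \<in> set q \<Longrightarrow> x \<noteq> y \<Longrightarrow> before q x y \<or> before q y x"
  by (induction q) auto

lemma before_conv_nth: "before q x y \<longleftrightarrow> (\<exists>a b. a < b \<and> b < length q \<and> q ! a = x \<and> q ! b = y)"
proof (induction q)
  case (Cons h q)
  show ?case
  proof
    assume "before (h # q) x y"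
    then consider "h = x" "y \<in> set q" | "before q x y" by auto
    then show "\<exists>a b. a < b \<and> b < length (h # q) \<and> (h # q) ! a = x \<and> (h # q) ! b = y"
    proof cases
      case 1
      then obtain b where "b < length q" "q ! b = y" by (auto simp: in_set_conv_nth)
      then show ?thesis using 1 by (intro exI[of _ 0] exI[of _ "Suc b"]) auto
    next
      case 2
      then obtain a b where "a < b" "b < length q" "q ! a = x" "q ! b = y" using Cons by auto
      then show ?thesis by (intro exI[of _ "Suc a"] exI[of _ "Suc b"]) auto
    qed
  next
    assume "\<exists>a b. a < b \<and> b < length (h # q) \<and> (h # q) ! a = x \<and> (h # q) ! b = y"
    then obtain a b where ab: "a < b" "b < length (h # q)" "(h # q) ! a = x" "(h # q) ! b = y"
      by blast
    then obtain b' where "b = Suc b'" by (cases b) auto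
    then show "before (h # q) x y" using ab Cons by (cases a) auto
  qed
qed simp

text \<open>If the heads differed, each would precede the other in one of the two words.\<close>

lemma list_eq_if_bf_eq:
  assumes "distinct p" "distinct q" "set p = set q" "\<And>x y. before p x y \<longleftrightarrow> before q x y"
  shows "p = q"
  using assms
proof (induction p arbitrary: q)
  case (Cons h p)
  then obtain h' q' where q: "q = h' # q'" by (cases q) auto
  have "h = h'"
  proof (rule ccontr)
    assume "h \<noteq> h'"
    then have "h \<in> set q'" "h' \<in> set p" using Cons.prems(3) q by auto
    then have "before q h' h" "before (h # p) h h'" using q by auto
    then show False using Cons.prems before_asym by metis
  qed
  moreover have "p = q'"
  proof (rule Cons.IH)
    have "set p = set (h # p) - {h}" "set q' = set q - {h}" using Cons.prems(1,2) q \<open>h = h'\<close> by auto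
    then show "set p = set q'" using Cons.prems(3) by (simp only:)
    fix x y
    show "before p x y \<longleftrightarrow> before q' x y"
      using Cons.prems(1,2) Cons.prems(4)[of x y] \<open>h = h'\<close> before_in_set[of p x y] before_in_set[of q' x y]
      unfolding q by auto
  qed (use Cons.prems q in auto)
  ultimately show ?case using q by simp
qed simp

lemma last_elem:
  assumes d: "distinct q" and "x \<in> set q" "Q x"
  obtains y where "y \<in> set q" "Q y" "\<And>z. Q z \<Longrightarrow> \<not> before q y z"
proof -
  have "\<exists>y\<in>set q. Q y \<and> (\<forall>z. Q z \<longrightarrow> \<not> before q y z)"
    using assms
  proof (induction q arbitrary: x)
    case (Cons h q)
    show ?case
    proof (cases "\<exists>x\<in>set q. Q x")
      case True
      then obtain x' where "x' \<in> set q" "Q x'" by blast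
      then obtain y where "y \<in> set q" "Q y" "\<forall>z. Q z \<longrightarrow> \<not> before q y z"
        using Cons.IH[of x'] Cons.prems by auto
      then show ?thesis using Cons.prems by (intro bexI[of _ y]) auto
    next
      case False
      then have "x = h" using Cons.prems by auto
      then show ?thesis using False Cons.prems by (intro bexI[of _ h]) (auto dest: before_in_set)
    qed
  qed simp
  then show thesis using that by blast
qed

lemma first_elem:
  assumes "distinct q" and "x \<in> set q" "Q x"
  obtains y where "y \<in> set q" "Q y" "\<And>z. Q z \<Longrightarrow> \<not> before q z y"
  using last_elem[of "rev q" x Q] assms by (auto simp: before_rev)

text \<open>The number counts the steps of the chain. A longest chain in the framed word can be taken to
  end in a frame entry, so the number is also that of entries of \<open>p\<close> in the chain.\<close>

fun lchain :: "'a::linorder list \<Rightarrow> nat \<Rightarrow> 'a \<Rightarrow> bool" where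
  "lchain q 0 x \<longleftrightarrow> True"
| "lchain q (Suc j) x \<longleftrightarrow> (\<exists>x'. before q x' x \<and> x' < x \<and> lchain q j x')"

fun uchain :: "'a::linorder list \<Rightarrow> nat \<Rightarrow> 'a \<Rightarrow> bool" where
  "uchain q 0 x \<longleftrightarrow> True"
| "uchain q (Suc j) x \<longleftrightarrow> (\<exists>x'. before q x x' \<and> x < x' \<and> uchain q j x')"

lemma lchain_SucD: "lchain q (Suc j) x \<Longrightarrow> lchain q j x"
proof (induction j arbitrary: x)
  case (Suc j)
  then show ?case by (subst (asm) lchain.simps) auto
qed simp

lemma uchain_SucD: "uchain q (Suc j) x \<Longrightarrow> uchain q j x"
proof (induction j arbitrary: x)
  case (Suc j)
  then show ?case by (subst (asm) uchain.simps) auto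
qed simp

lemma lchain_le: "lchain q j x \<Longrightarrow> i \<le> j \<Longrightarrow> lchain q i x"
  by (induction j) (auto simp: le_Suc_eq dest: lchain_SucD simp del: lchain.simps)

lemma uchain_le: "uchain q j x \<Longrightarrow> i \<le> j \<Longrightarrow> uchain q i x"
  by (induction j) (auto simp: le_Suc_eq dest: uchain_SucD simp del: uchain.simps)

lemma lchain_mono: "(\<And>x y. before p x y \<Longrightarrow> before q x y) \<Longrightarrow> lchain p j x \<Longrightarrow> lchain q j x"
  by (induction j arbitrary: x) auto

lemma uchain_mono: "(\<And>x y. before p x y \<Longrightarrow> before q x y) \<Longrightarrow> uchain p j x \<Longrightarrow> uchain q j x"
  by (induction j arbitrary: x) auto

section \<open>Deleting the middle entries\<close>

text \<open>For a framed permutation this is avoidance with \<open>i = a\<close> and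
  \<open>k = a + b\<close>: \<open>x\<close> plays the \<open>a\<close>-th and \<open>y\<close> the
  next entry of an increasing subsequence of length \<open>k\<close>, with the frame entries as end
  cases. A violating \<open>z\<close> completes an occurrence of a pattern.\<close>

definition interval_cond :: "nat \<Rightarrow> nat \<Rightarrow> 'a::linorder list \<Rightarrow> bool" where
  "interval_cond a b q \<longleftrightarrow> (\<forall>x y z. lchain q a x \<longrightarrow> uchain q b y \<longrightarrow> x < y \<longrightarrow>
     before q x z \<longrightarrow> before q z y \<longrightarrow> x < z \<and> z < y)"

text \<open>These are the entries to be deleted under \<open>interval_cond (Suc a) b\<close>, so
  \<open>i = a + 1\<close> and \<open>k = a + b + 1\<close>. Counting steps to the frame, such an
  entry is the \<open>i\<close>-th of an increasing subsequence of length \<open>k\<close>. With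
  this shift of indices, reverse complement simply exchanges \<open>a\<close> and
  \<open>b\<close>.\<close>

definition mid :: "nat \<Rightarrow> nat \<Rightarrow> 'a::linorder list \<Rightarrow> 'a set" where
  "mid a b q = {x \<in> set q. lchain q (Suc a) x \<and> uchain q (Suc b) x}"

definition core :: "nat \<Rightarrow> nat \<Rightarrow> 'a::linorder list \<Rightarrow> 'a list" where
  "core a b q = filter (\<lambda>x. x \<notin> mid a b q) q"

text \<open>The description refers to \<open>w\<close> and \<open>V\<close> only, not to a
  permutation from which \<open>w\<close> arises. Its symmetry in \<open>a\<close> and
  \<open>b\<close> under reverse complement is what links two neighbouring values of
  \<open>i\<close>.\<close>

definition cores :: "nat \<Rightarrow> nat \<Rightarrow> 'a::linorder set \<Rightarrow> 'a list set" where
  "cores a b V = {w. distinct w \<and> set w \<subseteq> V \<and> mid a b w = {} \<and>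
     (\<forall>t\<in>V - set w. \<exists>x y. before w x y \<and> x < t \<and> t < y \<and> lchain w a x \<and> uchain w b y)}"

definition interval_perms :: "nat \<Rightarrow> nat \<Rightarrow> 'a::linorder set \<Rightarrow> 'a list set" where
  "interval_perms a b V = {q. distinct q \<and> set q = V \<and> interval_cond a b q}"

section \<open>Chains that survive the deletion\<close>

lemma before_core: "before (core a b q) x y \<longleftrightarrow> before q x y \<and> x \<notin> mid a b q \<and> y \<notin> mid a b q"
  by (auto simp: core_def before_filter)

lemma set_core: "set (core a b q) = set q - mid a b q"
  by (auto simp: core_def)

lemma mid_subset: "mid a b q \<subseteq> set q"
  by (auto simp: mid_def)

lemma lchain_coreD: "lchain (core a b q) j x \<Longrightarrow> lchain q j x"
  by (rule lchain_mono[of "core a b q"]) (auto simp: before_core)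

lemma uchain_coreD: "uchain (core a b q) j x \<Longrightarrow> uchain q j x"
  by (rule uchain_mono[of "core a b q"]) (auto simp: before_core)

text \<open>The last candidate for \<open>y\<close> survives: if it were deleted, its own chain
  would supply a later candidate. Chains through deleted entries can thus be rerouted;
  \<open>mid_prev\<close> is dual, with the first candidate.\<close>

lemma mid_next:
  assumes d: "distinct q" and t: "t \<in> mid a b q"
  obtains y where "y \<in> set (core a b q)" "before q t y" "t < y" "uchain q b y"
proof -
  obtain y0 where y0: "before q t y0" "t < y0" "uchain q b y0" using t by (auto simp: mid_def)
  obtain y where y: "y \<in> set q" "before q t y \<and> t < y \<and> uchain q b y"
    "\<And>z. before q t z \<and> t < z \<and> uchain q b z \<Longrightarrow> \<not> before q y z"
    using last_elem[of q y0 "\<lambda>y. before q t y \<and> t < y \<and> uchain q b y"] y0 d before_in_set by metis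
  have "y \<notin> mid a b q"
  proof
    assume "y \<in> mid a b q"
    then obtain z where "before q y z" "y < z" "uchain q b z" by (auto simp: mid_def)
    then show False using y before_trans[OF d, of t y z] by fastforce
  qed
  then show thesis using that y by (auto simp: set_core)
qed

lemma mid_prev:
  assumes d: "distinct q" and t: "t \<in> mid a b q"
  obtains x where "x \<in> set (core a b q)" "before q x t" "x < t" "lchain q a x"
proof -
  obtain y0 where y0: "before q y0 t" "y0 < t" "lchain q a y0" using t by (auto simp: mid_def)
  obtain y where y: "y \<in> set q" "before q y t \<and> y < t \<and> lchain q a y"
    "\<And>z. before q z t \<and> z < t \<and> lchain q a z \<Longrightarrow> \<not> before q z y"
    using first_elem[of q y0 "\<lambda>y. before q y t \<and> y < t \<and> lchain q a y"] y0 d before_in_set by metis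
  have "y \<notin> mid a b q"
  proof
    assume "y \<in> mid a b q"
    then obtain z where "before q z y" "z < y" "lchain q a z" by (auto simp: mid_def)
    then show False using y before_trans[OF d, of z y t] by fastforce
  qed
  then show thesis using that y by (auto simp: set_core)
qed

text \<open>A deleted entry of the chain is replaced by the survivor from \<open>mid_next\<close>.
  That survivor is only known to have \<open>b\<close> steps above it, hence the bound on
  \<open>j\<close>.\<close>

lemma uchain_core:
  assumes d: "distinct q"
  shows "uchain q j z \<Longrightarrow> j \<le> b \<Longrightarrow> z \<in> set (core a b q) \<Longrightarrow> uchain (core a b q) j z"
proof (induction j arbitrary: z)
  case (Suc j)
  then obtain z' where z': "before q z z'" "z < z'" "uchain q j z'" by auto
  obtain y where "y \<in> set (core a b q)" "before q z y" "z < y" "uchain q j y"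
  proof (cases "z' \<in> mid a b q")
    case True
    then obtain y where y: "y \<in> set (core a b q)" "before q z' y" "z' < y" "uchain q b y"
      using mid_next[OF d] by blast
    show thesis
      using that[OF y(1)] before_trans[OF d z'(1) y(2)] z' y uchain_le[OF y(4), of j] Suc.prems by auto
  next
    case False
    then show thesis using that[of z'] z' before_in_set[OF z'(1)] by (auto simp: set_core)
  qed
  then show ?case using Suc.IH[of y] Suc.prems by (auto simp: before_core set_core)
qed simp

lemma lchain_core:
  assumes d: "distinct q"
  shows "lchain q j z \<Longrightarrow> j \<le> a \<Longrightarrow> z \<in> set (core a b q) \<Longrightarrow> lchain (core a b q) j z"
proof (induction j arbitrary: z)
  case (Suc j)
  then obtain z' where z': "before q z' z" "z' < z" "lchain q j z'" by auto
  obtain y where "y \<in> set (core a b q)" "before q y z" "y < z" "lchain q j y"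
  proof (cases "z' \<in> mid a b q")
    case True
    then obtain y where y: "y \<in> set (core a b q)" "before q y z'" "y < z'" "lchain q a y"
      using mid_prev[OF d] by blast
    show thesis
      using that[OF y(1)] before_trans[OF d y(2) z'(1)] z' y lchain_le[OF y(4), of j] Suc.prems by auto
  next
    case False
    then show thesis using that[of z'] z' before_in_set[OF z'(1)] by (auto simp: set_core)
  qed
  then show ?case using Suc.IH[of y] Suc.prems by (auto simp: before_core set_core)
qed simp

text \<open>Deletion creates no chains, so no survivor falls into the new \<open>mid\<close>. The
  survivors next to a deleted value keep their chains and form the required gap around it.\<close>

lemma core_in_cores:
  assumes d: "distinct q"
  shows "core a b q \<in> cores a b (set q)"
  unfolding cores_def
proof (intro CollectI conjI ballI)
  show "distinct (core a b q)" using d by (simp add: core_def)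
  show "set (core a b q) \<subseteq> set q" by (auto simp: set_core)
  show "mid a b (core a b q) = {}"
    using lchain_coreD[of a b q "Suc a"] uchain_coreD[of a b q "Suc b"] set_core[of a b q]
    by (auto simp: mid_def simp del: lchain.simps uchain.simps)
  fix t assume "t \<in> set q - set (core a b q)"
  then have t: "t \<in> mid a b q" by (auto simp: set_core)
  obtain x where x: "x \<in> set (core a b q)" "before q x t" "x < t" "lchain q a x"
    using mid_prev[OF d t] by blast
  obtain y where y: "y \<in> set (core a b q)" "before q t y" "t < y" "uchain q b y"
    using mid_next[OF d t] by blast
  show "\<exists>x y. before (core a b q) x y \<and> x < t \<and> t < y \<and> lchain (core a b q) a x \<and> uchain (core a b q) b y"
    using x y before_trans[OF d x(2) y(2)] lchain_core[OF d x(4), of a b] uchain_core[OF d y(4), of b a]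
    by (intro exI[of _ x] exI[of _ y]) (auto simp: before_core set_core)
qed

section \<open>The bijection between permutations and cores\<close>

lemma between_in_mid:
  assumes "interval_cond (Suc a) b q" "lchain q (Suc a) x" "uchain q b y" "x < y" "before q x z" "before q z y"
  shows "z \<in> mid a b q"
proof -
  have "x < z" "z < y" using assms unfolding interval_cond_def by blast+
  then have "lchain q (Suc a) z" "uchain q (Suc b) z" using assms lchain_SucD by fastforce+
  then show ?thesis using before_in_set[OF assms(5)] by (simp add: mid_def)
qed

text \<open>The right-hand side depends only on the core and the value \<open>t\<close>. If it held
  with \<open>t\<close> standing before \<open>z\<close>, then \<open>z\<close> would be positioned
  between \<open>t\<close> and \<open>y\<close>, and by \<open>between_in_mid\<close> it would have
  been deleted itself.\<close>

lemma before_mid_iff: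
  assumes d: "distinct q" and P: "interval_cond (Suc a) b q"
    and t: "t \<in> mid a b q" and z: "z \<in> set (core a b q)"
  shows "before q z t \<longleftrightarrow> (\<exists>y. before (core a b q) z y \<and> t < y \<and> uchain (core a b q) b y)"
proof
  assume "before q z t"
  obtain y where y: "y \<in> set (core a b q)" "before q t y" "t < y" "uchain q b y"
    using mid_next[OF d t] by blast
  then show "\<exists>y. before (core a b q) z y \<and> t < y \<and> uchain (core a b q) b y"
    using before_trans[OF d \<open>before q z t\<close> y(2)] uchain_core[OF d y(4), of b a] z
    by (auto simp: before_core set_core)
next
  assume "\<exists>y. before (core a b q) z y \<and> t < y \<and> uchain (core a b q) b y"
  then obtain y where y: "before q z y" "t < y" "uchain q b y" using uchain_coreD[of a b q b] by (auto simp: before_core)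
  show "before q z t"
  proof (rule ccontr)
    assume "\<not> before q z t"
    then have "before q t z" using before_total[of t q z] t z by (auto simp: set_core mid_def)
    then have "z \<in> mid a b q" using between_in_mid[OF P _ y(3) y(2) _ y(1)] t by (auto simp: mid_def)
    then show False using z by (simp add: set_core)
  qed
qed

text \<open>Suppose the larger \<open>t'\<close> stands first. A survivor \<open>y > t'\<close> with
  a chain above it follows \<open>t'\<close>. If \<open>y\<close> also followed \<open>t\<close>,
  then \<open>t\<close> would be positioned between \<open>t'\<close> and \<open>y\<close> with a
  value below both. So \<open>y\<close> separates the two, and deleted entries without a survivor
  between them increase.\<close>

lemma before_mid_mid_iff:
  assumes d: "distinct q" and P: "interval_cond (Suc a) b q"
    and t: "t \<in> mid a b q" "t' \<in> mid a b q" "t < t'"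
  shows "before q t t' \<longleftrightarrow> \<not> (\<exists>z\<in>set (core a b q). before q t' z \<and> before q z t)"
proof
  assume "before q t t'"
  then show "\<not> (\<exists>z\<in>set (core a b q). before q t' z \<and> before q z t)"
    using before_trans[OF d, of t t'] before_asym[OF d, of t] by blast
next
  assume *: "\<not> (\<exists>z\<in>set (core a b q). before q t' z \<and> before q z t)"
  show "before q t t'"
  proof (rule ccontr)
    assume "\<not> before q t t'"
    then have t't: "before q t' t" using before_total[of t q t'] t by (auto simp: mid_def)
    obtain y where y: "y \<in> set (core a b q)" "before q t' y" "t' < y" "uchain q b y"
      using mid_next[OF d t(2)] by blast
    have "\<not> before q t y"
    proof
      assume "before q t y"
      moreover have "lchain q (Suc a) t'" using t by (simp add: mid_def)
      ultimately have "t' < t" using P t't y(3,4) unfolding interval_cond_def by blast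
      then show False using t(3) by simp
    qed
    then have "before q y t" using before_total[of t q y] t y by (auto simp: mid_def set_core)
    then show False using * y by blast
  qed
qed

text \<open>The deleted values are those of \<open>V\<close> that are missing from the core, and the
  two preceding lemmas express their positions through the core.\<close>

lemma core_inj:
  "inj_on (core a b) (interval_perms (Suc a) b V)"
proof (rule inj_onI)
  fix p q :: "'a list"
  assume p: "p \<in> interval_perms (Suc a) b V" and q: "q \<in> interval_perms (Suc a) b V"
    and eq: "core a b p = core a b q"
  have d: "distinct p" "distinct q" "set p = V" "set q = V"
    "interval_cond (Suc a) b p" "interval_cond (Suc a) b q"
    using p q by (auto simp: interval_perms_def)
  have m: "mid a b p = V - set (core a b p)" "mid a b q = V - set (core a b q)"
    using d(3,4) mid_subset set_core by blast+
  have mm: "mid a b p = mid a b q" using m eq by simp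
  define w where "w = core a b p"
  have zt: "before p z t \<longleftrightarrow> before q z t" if "z \<in> set w" "t \<in> mid a b p" for z t
    using that before_mid_iff[of p a b t z] before_mid_iff[of q a b t z] d eq mm by (simp add: w_def)
  have tz: "before p t z \<longleftrightarrow> before q t z" if "z \<in> set w" "t \<in> mid a b p" for z t
  proof -
    have "t \<noteq> z" "t \<in> V" "z \<in> V" using that d by (auto simp: w_def set_core mid_def)
    then show ?thesis
      using zt[OF that] before_total[of t p z] before_total[of t q z] before_asym[of p] before_asym[of q] d by blast
  qed
  have tt: "before p t t' \<longleftrightarrow> before q t t'" if "t \<in> mid a b p" "t' \<in> mid a b p" "t < t'" for t t'
    using before_mid_mid_iff[of p a b t t'] before_mid_mid_iff[of q a b t t'] that d mm zt tz eq
    unfolding w_def by auto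
  show "p = q"
  proof (rule list_eq_if_bf_eq)
    fix x y
    show "before p x y \<longleftrightarrow> before q x y"
    proof (cases "x \<in> V \<and> y \<in> V")
      case False
      then show ?thesis using before_in_set d by metis
    next
      case True
      consider "x \<in> set w" "y \<in> set w" | "x \<in> set w" "y \<in> mid a b p" | "x \<in> mid a b p" "y \<in> set w"
        | "x \<in> mid a b p" "y \<in> mid a b p"
        using True m w_def by blast
      then show ?thesis
      proof cases
        case 1
        then show ?thesis using before_core[of a b p x y] before_core[of a b q x y] eq mm
          by (auto simp: w_def set_core)
      next
        case 4
        show ?thesis
        proof (cases x y rule: linorder_cases)
          case less
          then show ?thesis using tt 4 by blast
        next
          case equal
          then show ?thesis using before_irrefl d by metis
        next
          case greater
          then have "before p y x \<longleftrightarrow> before q y x" using tt 4 by blast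
          then show ?thesis
            using before_total[of x p y] before_total[of x q y] before_asym[of p] before_asym[of q] d True greater
            by blast
        qed
      qed (use zt tz in blast)+
    qed
  qed (use d in auto)
qed

text \<open>The missing values are inserted in increasing order, each directly in front of the last
  \<open>y > t\<close> of \<open>w\<close> with \<open>uchain w b y\<close>. This is the place that
  \<open>before_mid_iff\<close> prescribes.\<close>

lemma cores_surj:
  assumes "finite V" "w \<in> cores a b V"
  shows "\<exists>q\<in>interval_perms (Suc a) b V. core a b q = w"
  using assms
proof (induction "card (V - set w)" arbitrary: V)
  case 0
  then have V: "set w = V" "distinct w" "mid a b w = {}" by (auto simp: cores_def)
  have "interval_cond (Suc a) b w"
    unfolding interval_cond_def
  proof (intro allI impI)
    fix x y z
    assume *: "lchain w (Suc a) x" "uchain w b y" "x < y" "before w x z" "before w z y"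
    \<comment> \<open>The entry \<open>x\<close> would lie in the empty set
      \<open>mid a b w\<close>, so the premises never hold together.\<close>
    then have "uchain w (Suc b) x" using before_trans[OF V(2)] by auto
    then have "x \<in> mid a b w" using * before_in_set[OF *(4)] by (simp add: mid_def)
    then show "x < z \<and> z < y" using V by simp
  qed
  moreover have "core a b w = w" using V by (simp add: core_def)
  ultimately show ?case using V by (auto simp: interval_perms_def)
next
  case (Suc n)
  have w: "distinct w" "set w \<subseteq> V" "mid a b w = {}" using Suc.prems by (auto simp: cores_def)
  \<comment> \<open>Inserting the largest missing value last keeps every run that it enters increasing.\<close>
  define t where "t = Max (V - set w)"
  have fin: "finite (V - set w)" and ne: "V - set w \<noteq> {}"
    using Suc.prems(1) Suc.hyps(2) by (simp, metis card.empty nat.distinct(1))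
  then have t: "t \<in> V" "t \<notin> set w" unfolding t_def using Max_in by blast+
  have tmax: "s < t" if "s \<in> V - {t}" "s \<notin> set w" for s
    using Max_ge[OF fin, of s] that unfolding t_def by auto
  define V' where "V' = V - {t}"
  have "w \<in> cores a b V'" using Suc.prems t by (auto simp: cores_def V'_def)
  moreover have "n = card (V' - set w)"
  proof -
    have "V' - set w = (V - set w) - {t}" by (auto simp: V'_def)
    then show ?thesis using Suc(2) t by simp
  qed
  ultimately obtain r where r: "r \<in> interval_perms (Suc a) b V'" "core a b r = w"
    using Suc(1)[of V'] Suc.prems by (auto simp: V'_def)
  then have d: "distinct r" "set r = V'" and P: "interval_cond (Suc a) b r"
    by (auto simp: interval_perms_def)
  have bfw: "before w x y \<Longrightarrow> before r x y" for x y using before_core r(2) by metis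
  have midr: "mid a b r = V' - set w"
    using d(2) r(2) mid_subset set_core by blast
  obtain x0 y0 where xy0: "before w x0 y0" "x0 < t" "t < y0" "lchain w a x0" "uchain w b y0"
    using Suc.prems t unfolding cores_def by blast
  obtain y where y: "y \<in> set w" "t < y \<and> uchain w b y"
    and ylast: "\<And>z. t < z \<and> uchain w b z \<Longrightarrow> \<not> before w y z"
    using last_elem[of w y0 "\<lambda>y. t < y \<and> uchain w b y"] xy0 w(1) before_in_set[OF xy0(1)] by metis
  have upy: "uchain r b y" using y r(2) uchain_coreD by metis
  have dnx0: "lchain r a x0" using xy0 r(2) lchain_coreD by metis
  \<comment> \<open>Since \<open>y0\<close> competes for the role of \<open>y\<close>, the last
    candidate does not precede it. Hence \<open>x0\<close> stands before \<open>y\<close>, and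
    \<open>t\<close> is inserted behind \<open>x0\<close>.\<close>
  have "y0 = y \<or> before w y0 y"
    using ylast[of y0] xy0 before_total[of y w y0] y before_in_set[OF xy0(1)] by blast
  then have x0y: "before r x0 y" using xy0(1) before_trans[OF w(1)] bfw by metis
  have yr: "y \<in> set r" using y(1) r(2) by (auto simp: set_core)
  then obtain c e where ce: "r = c @ y # e" by (meson split_list)
  define q where "q = c @ t # y # e"
  have tr: "t \<notin> set r" using d by (simp add: V'_def)
  have dq: "distinct q" "set q = V" using d tr t unfolding q_def ce V'_def by auto
  have bfq: "before q x z \<longleftrightarrow> before r x z" if "x \<noteq> t" "z \<noteq> t" for x z
    using that tr by (auto simp: q_def ce before_append dest: before_in_set)
  have bfqt: "before q x t \<longleftrightarrow> before r x y" for x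
    using d(1) tr by (auto simp: q_def ce before_append dest: before_in_set)
  have bftq: "before q t x \<longleftrightarrow> x = y \<or> before r y x" for x
    using d(1) tr by (auto simp: q_def ce before_append dest: before_in_set)
  have bfrq: "before r x z \<Longrightarrow> before q x z" for x z
    using bfq tr before_in_set by metis
  \<comment> \<open>A chain step up to \<open>t\<close> can go to \<open>y\<close> instead, which
    stands right behind \<open>t\<close> and is larger. Dually, \<open>x0\<close> replaces
    \<open>t\<close> in \<open>dnq\<close>. So the insertion adds no chain of relevant length at any
    other entry.\<close>
  have upq: "uchain q j z \<Longrightarrow> j \<le> Suc b \<Longrightarrow> z \<noteq> t \<Longrightarrow> uchain r j z" for j z
  proof (induction j arbitrary: z)
    case (Suc j)
    then obtain z' where z': "before q z z'" "z < z'" "uchain q j z'" by auto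
    show ?case
    proof (cases "z' = t")
      case True
      then have "before r z y" "z < y" "uchain r j y"
        using z' bfqt y uchain_le[OF upy] Suc.prems by auto
      then show ?thesis by auto
    qed (use z' Suc bfq in auto)
  qed simp
  have dnq: "lchain q j z \<Longrightarrow> j \<le> Suc a \<Longrightarrow> z \<noteq> t \<Longrightarrow> lchain r j z" for j z
  proof (induction j arbitrary: z)
    case (Suc j)
    then obtain z' where z': "before q z' z" "z' < z" "lchain q j z'" by auto
    show ?case
    proof (cases "z' = t")
      case True
      then have "before r x0 z" using z' bftq x0y before_trans[OF d(1)] by metis
      moreover have "x0 < z" using True z' xy0 by auto
      ultimately show ?thesis using lchain_le[OF dnx0, of j] Suc.prems by auto
    qed (use z' Suc bfq in auto)
  qed simp
  have uprq: "uchain r j z \<Longrightarrow> uchain q j z" and dnrq: "lchain r j z \<Longrightarrow> lchain q j z" for j z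
    using uchain_mono lchain_mono bfrq by metis+
  have "lchain q (Suc a) t" using bfqt x0y xy0 dnrq[OF dnx0] by auto
  moreover have "uchain q (Suc b) t" using bftq y uprq[OF upy] by auto
  ultimately have midt: "t \<in> mid a b q" using t dq by (simp add: mid_def)
  have midq: "s \<in> mid a b q \<longleftrightarrow> s \<in> mid a b r" if "s \<noteq> t" for s
    using that upq[of "Suc b" s] dnq[of "Suc a" s] uprq[of "Suc b" s] dnrq[of "Suc a" s] dq d
    by (auto simp: mid_def V'_def simp del: lchain.simps uchain.simps)
  have "core a b q = filter (\<lambda>x. x \<notin> mid a b q) r"
    using midt by (simp add: core_def q_def ce)
  also have "\<dots> = filter (\<lambda>x. x \<notin> mid a b r) r"
  proof (rule filter_cong)
    fix x assume "x \<in> set r"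
    then have "x \<noteq> t" using tr by auto
    then show "x \<notin> mid a b q \<longleftrightarrow> x \<notin> mid a b r" using midq by simp
  qed simp
  finally have coreq: "core a b q = w" using r(2) by (simp add: core_def)
  have "interval_cond (Suc a) b q"
    unfolding interval_cond_def
  proof (intro allI impI)
    fix x u z
    assume A: "lchain q (Suc a) x" "uchain q b u" "x < u" "before q x z" "before q z u"
    have neq: "x \<noteq> z" "z \<noteq> u" "x \<noteq> u" using A before_irrefl[OF dq(1)] by auto
    have xu: "before q x u" using A before_trans[OF dq(1)] by metis
    consider "x = t" | "x \<noteq> t" "u = t" | "x \<noteq> t" "u \<noteq> t" "z = t" | "x \<noteq> t" "u \<noteq> t" "z \<noteq> t" by blast
    then show "x < z \<and> z < u"
    proof cases
      case 1
      \<comment> \<open>As \<open>t\<close> is the largest missing value, \<open>u\<close> belongs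
        to \<open>w\<close> and is a candidate for \<open>y\<close>, so it does not stand behind
        \<open>y\<close>. This leaves no room for \<open>z\<close> between \<open>t\<close> and
        \<open>u\<close>.\<close>
      then have u: "t < u" "uchain r b u" using A neq upq by auto
      have "u \<in> V'" using before_in_set[OF A(5)] dq neq 1 by (auto simp: V'_def)
      then have "u \<in> set w" using tmax[of u] less_asym[OF u(1)] unfolding V'_def by blast
      moreover from this have "uchain w b u" using uchain_core[OF d(1) u(2), of b a] r(2) by simp
      ultimately have "u = y \<or> before w u y" using ylast[of u] u before_total[of u w y] y by blast
      then have "u = y \<or> before r u y" using bfw by blast
      moreover have "before r z u" using A bfq neq 1 by metis
      ultimately have "before r z y" using before_trans[OF d(1)] by metis
      moreover have "z = y \<or> before r y z" using A bftq 1 by blast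
      ultimately show ?thesis using before_irrefl[OF d(1)] before_asym[OF d(1)] by metis
    next
      case 2
      \<comment> \<open>In \<open>r\<close> the entry \<open>y\<close> takes the role of
        \<open>t\<close> as upper end. Then \<open>z\<close> is one of the values inserted earlier,
        all of which are below \<open>t\<close>.\<close>
      have *: "lchain r (Suc a) x" "x < y" "before r x z" "before r z y"
        using A 2 dnq bfqt bfq y neq by auto
      then have "x < z" using P upy unfolding interval_cond_def by blast
      moreover have "z \<in> V' - set w" using between_in_mid[OF P *(1) upy *(2-4)] midr by simp
      then have "z < t" using tmax by (auto simp: V'_def)
      ultimately show ?thesis using 2 by simp
    next
      case 3
      \<comment> \<open>In \<open>r\<close> the entry \<open>y\<close> stands in for
        \<open>t\<close> and gives \<open>x < y\<close> and \<open>y <= u\<close>. Then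
        \<open>x\<close> lies in \<open>mid a b r\<close>, so it was inserted earlier and is below
        \<open>t\<close>.\<close>
      have x: "lchain r (Suc a) x" "before r x y"
        using dnq[OF A(1) le_refl 3(1)] bfqt[of x] A(4) 3(3) by (simp_all del: lchain.simps)
      have u: "uchain r b u" "u = y \<or> before r y u" 
        using upq[OF A(2) _ 3(2)] bftq[of u] A(5) 3(3) by simp_all
      have yu: "x < y \<and> y \<le> u"
      proof (cases "u = y")
        case False
        then have "before r y u" using u(2) by simp
        then have "x < y \<and> y < u" using P x u(1) A(3) unfolding interval_cond_def by blast
        then show ?thesis by auto
      qed (use A(3) in simp)
      then have "uchain r (Suc b) x" using x upy by auto
      then have "x \<in> mid a b r" using x before_in_set[OF x(2)] by (simp add: mid_def)
      then have "x < t" using midr tmax by (auto simp: V'_def)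
      then show ?thesis using 3 yu y by auto
    next
      case 4
      then show ?thesis using A P dnq[of "Suc a" x] upq[of b u] bfq
        unfolding interval_cond_def by (metis le_SucI le_refl)
    qed
  qed
  then show ?case using coreq dq by (auto simp: interval_perms_def)
qed

lemma core_bij:
  assumes "finite V"
  shows "bij_betw (core a b) (interval_perms (Suc a) b V) (cores a b V)"
  unfolding bij_betw_def
proof
  show "core a b ` interval_perms (Suc a) b V = cores a b V"
    using cores_surj[OF assms] core_in_cores by (fastforce simp: interval_perms_def)
qed (rule core_inj)

section \<open>Reverse complement\<close>

text \<open>On a word framed by \<open>0\<close> and \<open>N = n + 1\<close> this is the usual
  reverse complement of the inner permutation. Subtraction is truncated, hence the assumptions below
  that all values are at most \<open>N\<close>.\<close>

definition mirror :: "nat \<Rightarrow> nat list \<Rightarrow> nat list" where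
  "mirror N q = rev (map (\<lambda>x. N - x) q)"

lemma mirror_mirror: "set q \<subseteq> {..N} \<Longrightarrow> mirror N (mirror N q) = q"
  by (auto simp: mirror_def rev_map o_def intro!: map_idI)

lemma set_mirror: "set (mirror N q) = (\<lambda>x. N - x) ` set q"
  by (simp add: mirror_def)

lemma set_mirror_le: "set (mirror N q) \<subseteq> {..N}"
  by (auto simp: set_mirror)

lemma inj_on_mirror: "inj_on (\<lambda>x::nat. N - x) {..N}"
  by (auto intro!: inj_onI)

lemma distinct_mirror: "set q \<subseteq> {..N} \<Longrightarrow> distinct q \<Longrightarrow> distinct (mirror N q)"
  using inj_on_subset[OF inj_on_mirror] by (auto simp: mirror_def distinct_map)

lemma before_mirror:
  "set q \<subseteq> {..N} \<Longrightarrow> x \<le> N \<Longrightarrow> y \<le> N \<Longrightarrow> before (mirror N q) (N - x) (N - y) \<longleftrightarrow> before q y x"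
  using before_map_inj[OF inj_on_mirror, of q N y x] by (simp add: mirror_def before_rev)

lemma lchain_mirror:
  assumes q: "set q \<subseteq> {..N}"
  shows "x \<le> N \<Longrightarrow> lchain (mirror N q) j (N - x) \<longleftrightarrow> uchain q j x"
proof (induction j arbitrary: x)
  case (Suc j)
  show ?case
  proof
    assume "lchain (mirror N q) (Suc j) (N - x)"
    then obtain z where z: "before (mirror N q) z (N - x)" "z < N - x" "lchain (mirror N q) j z" by auto
    then have "z \<le> N" by auto
    define z' where "z' = N - z"
    have "z = N - z'" "z' \<le> N" using \<open>z \<le> N\<close> by (auto simp: z'_def)
    then have "before q x z'" "x < z'" "uchain q j z'" using z Suc before_mirror[OF q] by auto
    then show "uchain q (Suc j) x" by auto
  next
    assume "uchain q (Suc j) x"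
    then obtain z where z: "before q x z" "x < z" "uchain q j z" by auto
    then have "z \<le> N" using before_in_set[OF z(1)] q by auto
    then have "before (mirror N q) (N - z) (N - x)" "N - z < N - x" "lchain (mirror N q) j (N - z)"
      using z Suc before_mirror[OF q] by auto
    then show "lchain (mirror N q) (Suc j) (N - x)" by auto
  qed
qed simp

lemma uchain_mirror:
  assumes "set q \<subseteq> {..N}" "x \<le> N"
  shows "uchain (mirror N q) j (N - x) \<longleftrightarrow> lchain q j x"
  using lchain_mirror[OF set_mirror_le, of "N - x" N q j] assms mirror_mirror by simp

lemma interval_cond_mirror:
  assumes q: "set q \<subseteq> {..N}" and P: "interval_cond a b q"
  shows "interval_cond b a (mirror N q)"
  unfolding interval_cond_def
proof (intro allI impI)
  fix x y z
  assume *: "lchain (mirror N q) b x" "uchain (mirror N q) a y" "x < y"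
    "before (mirror N q) x z" "before (mirror N q) z y"
  then have le: "x \<le> N" "y \<le> N" "z \<le> N"
    using before_in_set[OF *(4)] before_in_set[OF *(5)] set_mirror_le by auto
  have m: "mirror N (mirror N q) = q" using q by (rule mirror_mirror)
  note s = set_mirror_le[of N q]
  have "uchain q b (N - x)" "lchain q a (N - y)" "before q (N - y) (N - z)" "before q (N - z) (N - x)"
    using * lchain_mirror[OF s] uchain_mirror[OF s] before_mirror[OF s] le m by auto
  moreover have "N - y < N - x" using * le by auto
  ultimately have "N - y < N - z" "N - z < N - x" using P unfolding interval_cond_def by blast+
  then show "x < z \<and> z < y" by auto
qed

text \<open>Only the two ends are constrained, so the notion also fits cores, where values may be
  missing.\<close>

definition framed :: "nat \<Rightarrow> nat list \<Rightarrow> bool" where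
  "framed N q \<longleftrightarrow> q \<noteq> [] \<and> hd q = 0 \<and> last q = N"

lemma framed_mirror: "framed N q \<Longrightarrow> framed N (mirror N q)"
  by (simp add: framed_def mirror_def hd_rev last_rev last_map hd_map)

lemma hd_notin_mid: "distinct q \<Longrightarrow> hd q \<notin> mid a b q"
  by (cases q) (auto simp: mid_def dest: before_in_set)

lemma last_notin_mid: "distinct q \<Longrightarrow> last q \<notin> mid a b q"
  by (cases q rule: rev_cases) (auto simp: mid_def before_append dest: before_in_set)

text \<open>The first entry has no chain below it and the last none above it, so neither is
  deleted.\<close>

lemma framed_core:
  assumes "distinct q" "q \<noteq> []"
  shows "framed N (core a b q) \<longleftrightarrow> framed N q"
proof -
  have "core a b q \<noteq> [] \<and> hd (core a b q) = hd q"
    using hd_notin_mid[OF assms(1), of a b] assms(2) by (cases q) (auto simp: core_def)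
  moreover have "last (core a b q) = last q"
    using last_notin_mid[OF assms(1), of a b] assms(2)
    by (cases q rule: rev_cases) (auto simp: core_def)
  ultimately show ?thesis using assms by (simp add: framed_def)
qed

lemma card_eq_involution:
  assumes "\<And>x. x \<in> A \<Longrightarrow> f x \<in> B \<and> f (f x) = x" "\<And>x. x \<in> B \<Longrightarrow> f x \<in> A \<and> f (f x) = x"
  shows "card A = card B"
  by (rule bij_betw_same_card[of f], rule bij_betw_byWitness[of A f]) (use assms in auto)

lemma mirror_interval_perms:
  assumes "q \<in> interval_perms a b {..N}" "framed N q"
  shows "mirror N q \<in> interval_perms b a {..N} \<and> framed N (mirror N q) \<and> mirror N (mirror N q) = q"
proof -
  have "(\<lambda>x. N - x) ` {..N} = {..N}"
  proof
    show "{..N} \<subseteq> (\<lambda>x. N - x) ` {..N}"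
    proof
      fix x assume "x \<in> {..N}"
      then have "x = N - (N - x)" "N - x \<in> {..N}" by auto
      then show "x \<in> (\<lambda>x. N - x) ` {..N}" by blast
    qed
  qed auto
  then show ?thesis
    using assms interval_cond_mirror[of q N a b] distinct_mirror[of q N] framed_mirror[of N q]
    by (auto simp: interval_perms_def set_mirror mirror_mirror)
qed

text \<open>Reverse complement exchanges chains below with chains above and carries a gap around
  \<open>N - t\<close> to one around \<open>t\<close>.\<close>

lemma mirror_cores:
  assumes "w \<in> cores a b {..N}"
  shows "mirror N w \<in> cores b a {..N}"
proof -
  have w: "distinct w" "set w \<subseteq> {..N}" "mid a b w = {}" using assms by (auto simp: cores_def)
  have "mid b a (mirror N w) = {}"
  proof (rule ccontr)
    assume "mid b a (mirror N w) \<noteq> {}"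
    then obtain x where x: "x \<in> set w" "lchain (mirror N w) (Suc b) (N - x)" "uchain (mirror N w) (Suc a) (N - x)"
      unfolding mid_def set_mirror by blast
    have le: "x \<le> N" using x(1) w(2) by auto
    have "x \<in> mid a b w"
      unfolding mid_def using x lchain_mirror[OF w(2) le] uchain_mirror[OF w(2) le] by blast
    then show False using w(3) by simp
  qed
  moreover have "\<exists>x y. before (mirror N w) x y \<and> x < t \<and> t < y \<and> lchain (mirror N w) b x \<and> uchain (mirror N w) a y"
    if t: "t \<in> {..N} - set (mirror N w)" for t
  proof -
    have "N - t \<notin> set w"
    proof
      assume "N - t \<in> set w"
      then have "N - (N - t) \<in> set (mirror N w)" unfolding set_mirror by blast
      then show False using t by simp
    qed
    then have "N - t \<in> {..N} - set w" by simp
    then obtain x y where xy: "before w x y" "x < N - t" "N - t < y" "lchain w a x" "uchain w b y"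
      using assms unfolding cores_def by blast
    have le: "x \<le> N" "y \<le> N" using before_in_set[OF xy(1)] w(2) by auto
    show ?thesis
      using xy le before_mirror[OF w(2)] lchain_mirror[OF w(2)] uchain_mirror[OF w(2)] t
      by (intro exI[of _ "N - y"] exI[of _ "N - x"]) auto
  qed
  ultimately show ?thesis using distinct_mirror[OF w(2,1)] set_mirror_le
    by (auto simp: cores_def)
qed

section \<open>Counting framed permutations\<close>

definition framed_perms :: "nat \<Rightarrow> nat \<Rightarrow> nat \<Rightarrow> nat list set" where
  "framed_perms a b N = {q \<in> interval_perms a b {..N}. framed N q}"

lemma card_framed_perms_mirror: "card (framed_perms a b N) = card (framed_perms b a N)"
  by (rule card_eq_involution[of _ "mirror N"])
    (use mirror_interval_perms in \<open>auto simp: framed_perms_def\<close>)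

lemma card_framed_perms_core:
  "card (framed_perms (Suc a) b N) = card {w \<in> cores a b {..N}. framed N w}"
proof (rule bij_betw_same_card)
  have *: "framed N (core a b q) \<longleftrightarrow> framed N q" if "q \<in> interval_perms (Suc a) b {..N}" for q
    using that by (intro framed_core) (auto simp: interval_perms_def)
  have "cores a b {..N} = core a b ` interval_perms (Suc a) b {..N}"
    using bij_betw_imp_surj_on[OF core_bij[of "{..N}" a b]] by simp
  then have "core a b ` framed_perms (Suc a) b N = {w \<in> cores a b {..N}. framed N w}"
    using * unfolding framed_perms_def by auto
  then show "bij_betw (core a b) (framed_perms (Suc a) b N) {w \<in> cores a b {..N}. framed N w}"
    using core_inj[of a b "{..N}"] unfolding bij_betw_def framed_perms_def
    by (auto intro: inj_on_subset)
qed

text \<open>The pair \<open>(Suc a, b)\<close> passes to cores for \<open>(a, b)\<close>, by reverse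
  complement to cores for \<open>(b, a)\<close>, back to permutations for \<open>(Suc b, a)\<close>,
  and by reverse complement of permutations to \<open>(a, Suc b)\<close>. The two reflections differ
  by one index, which yields the shift.\<close>

lemma card_framed_perms_shift: "card (framed_perms (Suc a) b N) = card (framed_perms a (Suc b) N)"
proof -
  have m: "mirror N (mirror N w) = w" if "w \<in> cores c d {..N}" for w c d
    using that by (intro mirror_mirror) (auto simp: cores_def)
  have "card {w \<in> cores a b {..N}. framed N w} = card {w \<in> cores b a {..N}. framed N w}"
    by (rule card_eq_involution[of _ "mirror N"])
      (use mirror_cores framed_mirror m in auto)
  then show ?thesis
    using card_framed_perms_core card_framed_perms_mirror by metis
qed

lemma card_framed_perms:
  "a \<le> k \<Longrightarrow> card (framed_perms a (k - a) N) = card (framed_perms 0 k N)"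
proof (induction a)
  case (Suc a)
  then have "k - a = Suc (k - Suc a)" by simp
  then show ?case using Suc card_framed_perms_shift[of a "k - Suc a" N] by simp
qed simp

section \<open>Occurrences of the patterns as increasing chains\<close>

text \<open>Chains of values become the index sequences used by pattern containment. Here the
  sequence is extended at its end; in \<open>uchain_chain\<close> it is extended in front.\<close>

lemma lchain_chain:
  assumes "distinct q"
  shows "lchain q i (q ! c) \<Longrightarrow> c < length q \<Longrightarrow>
    \<exists>F. F i = c \<and> (\<forall>j<i. F j < F (Suc j) \<and> q ! F j < q ! F (Suc j))"
proof (induction i arbitrary: c)
  case 0
  show ?case by (intro exI[of _ "\<lambda>_. c"]) simp
next
  case (Suc i)
  then obtain x where x: "before q x (q ! c)" "x < q ! c" "lchain q i x" by auto
  then obtain d where d: "d < c" "x = q ! d"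
    using assms Suc.prems(2) by (metis before_conv_nth nth_eq_iff_index_eq)
  then obtain F where F: "F i = d" "\<forall>j<i. F j < F (Suc j) \<and> q ! F j < q ! F (Suc j)"
    using Suc.IH[of d] x Suc.prems by auto
  show ?case
    using F d x by (intro exI[of _ "F(Suc i := c)"]) (auto simp: less_Suc_eq)
qed

lemma uchain_chain:
  assumes "distinct q"
  shows "uchain q i (q ! c) \<Longrightarrow> c < length q \<Longrightarrow>
    \<exists>F. F 0 = c \<and> F i < length q \<and> (\<forall>j<i. F j < F (Suc j) \<and> q ! F j < q ! F (Suc j))"
proof (induction i arbitrary: c)
  case 0
  then show ?case by (intro exI[of _ "\<lambda>_. c"]) simp
next
  case (Suc i)
  then obtain x where x: "before q (q ! c) x" "q ! c < x" "uchain q i x" by auto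
  then obtain d where d: "c < d" "d < length q" "x = q ! d"
    using assms Suc.prems(2) unfolding before_conv_nth by (metis nth_eq_iff_index_eq order.strict_trans)
  then obtain F where F: "F 0 = d" "F i < length q"
      "\<forall>j<i. F j < F (Suc j) \<and> q ! F j < q ! F (Suc j)"
    using Suc.IH[of d] x Suc.prems by auto
  show ?case
    using F d x by (intro exI[of _ "\<lambda>j. case j of 0 \<Rightarrow> c | Suc j \<Rightarrow> F j"])
      (auto split: nat.splits)
qed

lemma lchain_if_chain:
  "(\<And>j. j < i \<Longrightarrow> F j < F (Suc j) \<and> F (Suc j) < length q \<and> q ! F j < q ! F (Suc j)) \<Longrightarrow>
    lchain q i (q ! F i)"
proof (induction i)
  case (Suc i)
  then have "lchain q i (q ! F i)" by auto
  moreover have "before q (q ! F i) (q ! F (Suc i))" using Suc.prems[of i] by (auto simp: before_conv_nth)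
  ultimately show ?case using Suc.prems[of i] by auto
qed simp

lemma uchain_if_chain:
  "(\<And>j. c \<le> j \<Longrightarrow> j < c + i \<Longrightarrow> F j < F (Suc j) \<and> F (Suc j) < length q \<and> q ! F j < q ! F (Suc j)) \<Longrightarrow>
    uchain q i (q ! F c)"
proof (induction i arbitrary: c)
  case (Suc i)
  then have "uchain q i (q ! F (Suc c))" by auto
  moreover have "before q (q ! F c) (q ! F (Suc c))" using Suc.prems[of c] by (auto simp: before_conv_nth)
  ultimately show ?case using Suc.prems[of c] by auto
qed simp

text \<open>Monotonicity away from one index \<open>c\<close> follows from the neighbouring steps
  and one step across \<open>c\<close>. For \<open>c > m\<close> nothing is skipped and this is
  ordinary strict monotonicity.\<close>

lemma skip_mono:
  fixes Q :: "nat \<Rightarrow> nat"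
  assumes step: "\<And>j. j < m \<Longrightarrow> j \<noteq> c \<Longrightarrow> Suc j \<noteq> c \<Longrightarrow> Q j < Q (Suc j)"
    and skip: "0 < c \<Longrightarrow> c < m \<Longrightarrow> Q (c - 1) < Q (Suc c)"
  shows "a < b \<Longrightarrow> b \<le> m \<Longrightarrow> a \<noteq> c \<Longrightarrow> b \<noteq> c \<Longrightarrow> Q a < Q b"
proof (induction b rule: less_induct)
  case (less b)
  \<comment> \<open>The predecessor of \<open>b\<close> once \<open>c\<close> is left out.\<close>
  define b' where "b' = (if b = Suc c then c - 1 else b - 1)"
  have b': "b' < b" "a \<le> b'" "b' \<noteq> c" using less.prems by (auto simp: b'_def)
  have "Q b' < Q b"
    using less.prems step[of "b - 1"] skip by (auto simp: b'_def)
  then show ?case using less.IH[of b'] less.prems b' by (cases "a = b'") auto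
qed

lemma sorted_wrt_delete_iff:
  assumes "i < length xs"
  shows "sorted_wrt R (take i xs @ drop (Suc i) xs) \<longleftrightarrow>
    (\<forall>a b. a < b \<longrightarrow> b < length xs \<longrightarrow> a \<noteq> i \<longrightarrow> b \<noteq> i \<longrightarrow> R (xs ! a) (xs ! b))"
    (is "sorted_wrt R ?ys \<longleftrightarrow> ?r")
proof -
  have nth: "?ys ! a = xs ! (if a < i then a else Suc a)" if "a < length xs - 1" for a
    using that assms by (auto simp: nth_append min_def)
  have len: "length ?ys = length xs - 1" using assms by auto
  show ?thesis
  proof
    assume s: "sorted_wrt R ?ys"
    show ?r
    proof (intro allI impI)
      fix a b assume ab: "a < b" "b < length xs" "a \<noteq> i" "b \<noteq> i"
      define a' b' where "a' = (if a < i then a else a - 1)" and "b' = (if b < i then b else b - 1)"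
      have "a' < b'" "b' < length xs - 1" using ab assms by (auto simp: a'_def b'_def)
      then have "R (?ys ! a') (?ys ! b')" using s len by (simp add: sorted_wrt_iff_nth_less)
      moreover have "?ys ! a' = xs ! a" "?ys ! b' = xs ! b"
        using nth[of a'] nth[of b'] \<open>a' < b'\<close> \<open>b' < length xs - 1\<close> ab
        by (auto simp: a'_def b'_def)
      ultimately show "R (xs ! a) (xs ! b)" by simp
    qed
  next
    assume r: ?r
    show "sorted_wrt R ?ys"
      unfolding sorted_wrt_iff_nth_less
    proof (intro allI impI)
      fix a b assume "a < b" "b < length ?ys"
      then show "R (?ys ! a) (?ys ! b)" using r nth[of a] nth[of b] len by auto
    qed
  qed
qed

section \<open>Containment in terms of positions\<close>

lemma permsD: "p \<in> perms n \<Longrightarrow> set p = {1..n} \<and> distinct p"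
  unfolding perms_def by (auto simp: permutations_of_set_def)

lemma perms_length: "p \<in> perms n \<Longrightarrow> length p = n"
  using permsD[of p n] distinct_card[of p] by simp

lemma sorted_perm_nth:
  assumes "p \<in> perms n" "sorted_wrt (<) p" "j < n"
  shows "p ! j = j + 1"
proof -
  have "p = [1..<n + 1]"
  proof (rule sorted_distinct_set_unique)
    show "sorted p" using assms(2) by (simp add: strict_sorted_iff)
    show "set p = set [1..<n + 1]" 
      using permsD[OF assms(1)]
      by (simp only: set_upt Suc_eq_plus1[symmetric] atLeastLessThanSuc_atLeastAtMost)
  qed (use permsD[OF assms(1)] in \<open>simp_all del: upt_Suc\<close>)
  then show ?thesis using assms(3) by (simp del: upt_Suc)
qed

text \<open>An increasing pattern would have \<open>r ! i = i + 1\<close>, so the patterns of the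
  set are not increasing. Conversely, the standardization of the chosen entries is a pattern of the
  set: if the entry at index \<open>i\<close> had rank \<open>i + 1\<close>, exactly the
  \<open>i\<close> entries in front of it would be smaller, and the whole selection would
  increase.\<close>

lemma contains_M_iff:
  assumes "i \<le> k" "distinct p"
  shows "(\<exists>r\<in>M k (i + 1) (i + 1). contains p r) \<longleftrightarrow>
    (\<exists>f. strict_mono_on {..k} f \<and> f ` {..k} \<subseteq> {..<length p} \<and>
      (\<forall>a b. a < b \<longrightarrow> b \<le> k \<longrightarrow> a \<noteq> i \<longrightarrow> b \<noteq> i \<longrightarrow> p ! f a < p ! f b) \<and>
      \<not> (\<forall>a b. a < b \<longrightarrow> b \<le> k \<longrightarrow> p ! f a < p ! f b))"
    (is "?l \<longleftrightarrow> (\<exists>f. ?r f)")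
proof
  assume ?l
  then obtain r f where r: "r \<in> M k (i + 1) (i + 1)"
    and f: "strict_mono_on {..<length r} f" "f ` {..<length r} \<subseteq> {..<length p}"
      "\<forall>a<length r. \<forall>b<length r. r ! a < r ! b \<longleftrightarrow> p ! f a < p ! f b"
    unfolding contains_def by blast
  have rp: "r \<in> perms (k + 1)" "r ! i \<noteq> i + 1" "sorted_wrt (<) (take i r @ drop (Suc i) r)"
    using r by (auto simp: M_def)
  have len: "length r = Suc k" using perms_length[OF rp(1)] by simp
  have "\<not> sorted_wrt (<) r" using sorted_perm_nth[OF rp(1), of i] rp assms by auto
  then have "\<not> (\<forall>a b. a < b \<longrightarrow> b \<le> k \<longrightarrow> p ! f a < p ! f b)"
    using f(3) len by (auto simp: sorted_wrt_iff_nth_less less_Suc_eq_le)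
  moreover have "\<forall>a b. a < b \<longrightarrow> b \<le> k \<longrightarrow> a \<noteq> i \<longrightarrow> b \<noteq> i \<longrightarrow> p ! f a < p ! f b"
    using rp(3) f(3) len assms by (subst (asm) sorted_wrt_delete_iff) (auto simp: less_Suc_eq_le)
  ultimately show "\<exists>f. ?r f" using f(1,2) len
    by (intro exI[of _ f]) (auto simp: lessThan_Suc_atMost)
next
  assume "\<exists>f. ?r f"
  then obtain f where f: "strict_mono_on {..k} f" "f ` {..k} \<subseteq> {..<length p}"
    and srt: "\<And>a b. a < b \<Longrightarrow> b \<le> k \<Longrightarrow> a \<noteq> i \<Longrightarrow> b \<noteq> i \<Longrightarrow> p ! f a < p ! f b"
    and nsrt: "\<not> (\<forall>a b. a < b \<longrightarrow> b \<le> k \<longrightarrow> p ! f a < p ! f b)" by blast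
  define v where "v a = p ! f a" for a
  have inj: "v a = v b \<longleftrightarrow> a = b" if "a \<le> k" "b \<le> k" for a b
    using that f assms(2) strict_mono_on_imp_inj_on[OF f(1)]
    by (auto simp: v_def nth_eq_iff_index_eq image_subset_iff inj_on_def)
  \<comment> \<open>The size of \<open>L a\<close> is the rank of \<open>v a\<close> among the
    selected values, so \<open>g\<close> lists the standardization.\<close>
  define L where "L a = {b \<in> {..k}. v b \<le> v a}" for a
  define g where "g a = card (L a)" for a
  have fin: "finite (L a)" for a by (simp add: L_def)
  have g_less: "g a < g b" if "v a < v b" "a \<le> k" "b \<le> k" for a b
  proof -
    have "b \<in> L b" "b \<notin> L a" "L a \<subseteq> L b" using that by (auto simp: L_def)
    then have "L a \<subset> L b" by blast
    then show ?thesis using psubset_card_mono[OF fin] by (simp add: g_def)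
  qed
  have g_iff: "g a < g b \<longleftrightarrow> v a < v b" if "a \<le> k" "b \<le> k" for a b
    using that g_less[of a b] g_less[of b a] inj[of a b] by (cases "v a" "v b" rule: linorder_cases) auto
  define r where "r = map g [0..<Suc k]"
  have rn: "r ! a = g a" if "a \<le> k" for a using that by (simp add: r_def nth_map del: upt_Suc)
  have len: "length r = Suc k" by (simp add: r_def)
  have inj_g: "inj_on g {..k}"
  proof (rule inj_onI)
    fix a b assume "a \<in> {..k}" "b \<in> {..k}" "g a = g b"
    then have "\<not> v a < v b" "\<not> v b < v a" "a \<le> k" "b \<le> k" using g_less by fastforce+
    then show "a = b" using inj by (meson linorder_neqE_nat)
  qed
  have "g ` {..k} \<subseteq> {1..k + 1}"
  proof clarify
    fix a assume a: "a \<le> k"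
    have "card (L a) \<le> card {..k}" by (rule card_mono) (auto simp: L_def)
    moreover have "a \<in> L a" using a by (simp add: L_def)
    then have "card (L a) > 0" using fin card_gt_0_iff by blast
    ultimately show "g a \<in> {1..k + 1}" by (simp add: g_def)
  qed
  then have "g ` {..k} = {1..k + 1}"
    by (intro card_subset_eq) (auto simp: card_image[OF inj_g])
  moreover have "{0..<Suc k} = {..k}" by auto
  ultimately have rp: "r \<in> perms (k + 1)"
    using inj_g by (simp add: perms_def permutations_of_set_def r_def distinct_map del: upt_Suc)
  have "g i \<noteq> i + 1"
  proof
    assume gi: "g i = i + 1"
    have ik: "i \<le> k" by fact
    define B where "B = L i - {i}"
    have Bi: "card B = i" using gi ik fin by (simp add: B_def g_def L_def)
    have B: "B = {b. b \<le> k \<and> b \<noteq> i \<and> v b < v i}"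
      using inj ik by (auto simp: B_def L_def le_less)
    have below: "v b < v i" if "b < i" for b
    proof (rule ccontr)
      assume nb: "\<not> v b < v i"
      \<comment> \<open>Apart from index \<open>i\<close> the values increase, so from
        \<open>b\<close> onwards none is below \<open>v i\<close>. Then fewer than \<open>i\<close>
        values are below it.\<close>
      have "B \<subseteq> {..<b}"
      proof
        fix c assume c: "c \<in> B"
        show "c \<in> {..<b}"
        proof (rule ccontr)
          assume "c \<notin> {..<b}"
          then have "v b \<le> v c" using srt[of b c] that c B by (cases "b = c") (auto simp: v_def)
          then show False using c B nb by auto
        qed
      qed
      then have "card B \<le> b" using card_mono[of "{..<b}" B] by simp
      then show False using Bi that by simp
    qed
    have "{..<i} \<subseteq> B" using below ik by (auto simp: B)
    moreover have "finite B" using fin by (simp add: B_def)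
    ultimately have Beq: "B = {..<i}" using card_subset_eq[of B "{..<i}"] Bi by simp
    have above: "v i < v b" if "i < b" "b \<le> k" for b
    proof -
      have "b \<notin> B" using that Beq by simp
      then show ?thesis using that B inj[of i b] ik by force
    qed
    have "\<forall>a b. a < b \<longrightarrow> b \<le> k \<longrightarrow> p ! f a < p ! f b"
      using srt below above unfolding v_def by metis
    then show False using nsrt by simp
  qed
  then have "r ! i \<noteq> i + 1" using rn assms by simp
  moreover have "sorted_wrt (<) (take i r @ drop (Suc i) r)"
    using assms len srt g_iff by (subst sorted_wrt_delete_iff) (auto simp: rn v_def)
  ultimately have "r \<in> M k (i + 1) (i + 1)" using rp by (simp add: M_def)
  moreover have "contains p r"
    unfolding contains_def using f g_iff len
    by (intro exI[of _ f]) (auto simp: lessThan_Suc_atMost rn v_def less_Suc_eq_le)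
  ultimately show ?l by blast
qed

section \<open>Permutations framed by \<open>0\<close> and \<open>n + 1\<close>\<close>

context
  fixes n :: nat and p :: "nat list"
  assumes p: "p \<in> perms n"
begin

private abbreviation "q \<equiv> 0 # p @ [n + 1]"

lemma frame_props: "set q = {..n + 1}" "distinct q" "length q = n + 2"
  using permsD[OF p] perms_length[OF p] by (auto simp: less_Suc_eq_le)

lemma frame_before:
  "v \<in> {1..n + 1} \<Longrightarrow> before q 0 v" "v \<in> {..n} \<Longrightarrow> before q v (n + 1)"
  using permsD[OF p] by (auto simp: before_append)

lemma frame_nth: "j < n \<Longrightarrow> q ! Suc j = p ! j" "q ! Suc n = n + 1"
  using perms_length[OF p] by (auto simp: nth_append)

text \<open>For \<open>i = 0\<close> or \<open>l = 0\<close> a violation may have \<open>x\<close> or \<open>y\<close> inside \<open>p\<close>;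
  such a violation yields another one at the added end point.\<close>

lemma interval_violation:
  assumes "\<not> interval_cond i l q" "0 < i + l"
  obtains x y z where "lchain q i x" "uchain q l y" "x < y" "before q x z" "before q z y" "\<not> (x < z \<and> z < y)"
    "i = 0 \<Longrightarrow> x = 0" "l = 0 \<Longrightarrow> y = n + 1"
proof -
  obtain x y z where xyz: "lchain q i x" "uchain q l y" "x < y" "before q x z" "before q z y"
      "\<not> (x < z \<and> z < y)"
    using assms unfolding interval_cond_def by blast
  have mem: "x \<le> n + 1" "y \<le> n + 1" "z \<le> n + 1"
    using before_in_set[OF xyz(4)] before_in_set[OF xyz(5)] frame_props(1) by auto
  have neq: "x \<noteq> z" "z \<noteq> y" using xyz before_irrefl[OF frame_props(2)] by auto
  have z0: "z \<noteq> 0"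
    using xyz(4) permsD[OF p] by (auto simp: before_append dest: before_in_set)
  have zn: "z \<noteq> n + 1"
    using xyz(5) permsD[OF p] by (auto simp: before_append dest: before_in_set)
  consider "i = 0" "l > 0" | "i > 0" "l = 0" | "i > 0" "l > 0" using assms(2) by linarith
  then show thesis
  proof cases
    case 1
    show thesis
    proof (cases "z < y")
      case True
      \<comment> \<open>The violation now means \<open>z < x\<close>. With \<open>0\<close> as lower
        and \<open>z\<close> as upper end, \<open>x\<close> is an intermediate entry that is too
        large.\<close>
      then have "uchain q (Suc l) z" using xyz by (subst uchain.simps) blast
      then have "uchain q l z" by (rule uchain_SucD)
      then show thesis
        using that[of 0 z x] True 1 xyz neq z0 frame_before(1)[of x] mem by auto
    next
      case False
      then show thesis
        using that[of 0 y z] 1 xyz neq z0 frame_before(1)[of z] mem by auto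
    qed
  next
    case 2
    show thesis
    proof (cases "x < z")
      case True
      \<comment> \<open>Dually \<open>y < z\<close>: with \<open>z\<close> as lower and
        \<open>n + 1\<close> as upper end, \<open>y\<close> is an intermediate entry that is too
        small.\<close>
      then have "lchain q (Suc i) z" using xyz by (subst lchain.simps) blast
      then have "lchain q i z" by (rule lchain_SucD)
      then show thesis
        using that[of z "n + 1" y] True 2 xyz neq zn frame_before(2)[of y] mem by auto
    next
      case False
      then show thesis
        using that[of x "n + 1" z] 2 xyz neq zn frame_before(2)[of z] mem by auto
    qed
  next
    case 3
    then show thesis using that xyz by auto
  qed
qed

text \<open>The \<open>k + 1\<close> positions of an occurrence, together with the two frame
  positions, correspond to the \<open>k + 3\<close> positions of a violation: the chain ending in
  \<open>x\<close>, the entry \<open>z\<close>, and the chain starting at \<open>y\<close>. Index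
  \<open>i\<close> of the pattern is index \<open>Suc i\<close> of the longer sequence.\<close>

lemma contains_M_iff_violation:
  assumes k: "1 \<le> k" "i \<le> k"
  shows "(\<exists>r\<in>M k (i + 1) (i + 1). contains p r) \<longleftrightarrow> \<not> interval_cond i (k - i) q"
proof -
  note len = perms_length[OF p] and dq = frame_props(2) and lq = frame_props(3)
  have dp: "distinct p" using permsD[OF p] by simp
  show ?thesis
    unfolding contains_M_iff[OF k(2) dp]
  proof
    assume "\<exists>f. strict_mono_on {..k} f \<and> f ` {..k} \<subseteq> {..<length p} \<and>
      (\<forall>a b. a < b \<longrightarrow> b \<le> k \<longrightarrow> a \<noteq> i \<longrightarrow> b \<noteq> i \<longrightarrow> p ! f a < p ! f b) \<and>
      \<not> (\<forall>a b. a < b \<longrightarrow> b \<le> k \<longrightarrow> p ! f a < p ! f b)"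
    then obtain f where f: "strict_mono_on {..k} f" "f ` {..k} \<subseteq> {..<length p}"
      and srt: "\<And>a b. a < b \<Longrightarrow> b \<le> k \<Longrightarrow> a \<noteq> i \<Longrightarrow> b \<noteq> i \<Longrightarrow> p ! f a < p ! f b"
      and nsrt: "\<not> (\<forall>a b. a < b \<longrightarrow> b \<le> k \<longrightarrow> p ! f a < p ! f b)" by blast
    \<comment> \<open>Positions in the framed word: \<open>0\<close> and \<open>n + 1\<close> are
      the frame, and the successor accounts for the frame entry in front of
      \<open>p\<close>.\<close>
    define F where "F j = (case j of 0 \<Rightarrow> 0 | Suc j \<Rightarrow> if j \<le> k then Suc (f j) else n + 1)" for j
    define Q where "Q j = q ! F j" for j
    have fn: "f j < n" if "j \<le> k" for j using f(2) that len by auto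
    have Q0: "Q 0 = 0" by (simp add: Q_def F_def)
    have Qn: "Q (Suc (Suc k)) = n + 1" using frame_nth by (simp add: Q_def F_def)
    have Qm: "Q (Suc j) = p ! f j" if "j \<le> k" for j
      using that fn frame_nth by (simp add: Q_def F_def)
    have pr: "1 \<le> p ! f j \<and> p ! f j \<le> n" if "j \<le> k" for j
      using nth_mem[of "f j" p] fn[OF that] len permsD[OF p] by auto
    have Fm: "F j < F (Suc j)" if "j \<le> Suc k" for j
      using that fn strict_mono_onD[OF f(1)] by (auto simp: F_def split: nat.splits)
    have Fl: "F j < length q" if "j \<le> Suc (Suc k)" for j
      using that fn[of "j - 1"] lq by (auto simp: F_def split: nat.splits)
    have pos: "0 < p ! f j" if "j \<le> k" for j using pr[OF that] by simp
    have Qs: "Q a < Q b" if "a < b" "b \<le> Suc (Suc k)" "a \<noteq> Suc i" "b \<noteq> Suc i" for a b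
      using that Q0 Qn Qm pr pos srt k
      by (cases a; cases b) (auto simp: le_Suc_eq less_Suc_eq_le)
    have 1: "lchain q i (Q i)" unfolding Q_def
      by (rule lchain_if_chain) (use Fm Fl Qs k in \<open>auto simp: Q_def\<close>)
    have 2: "uchain q (k - i) (Q (Suc (Suc i)))" unfolding Q_def
      by (rule uchain_if_chain) (use Fm Fl Qs k in \<open>auto simp: Q_def\<close>)
    have 3: "Q i < Q (Suc (Suc i))" using Qs k by auto
    have 4: "before q (Q i) (Q (Suc i))" "before q (Q (Suc i)) (Q (Suc (Suc i)))"
    proof -
      have bfs: "before q (Q j) (Q (Suc j))" if "j \<le> Suc k" for j
        unfolding before_conv_nth Q_def using Fm[OF that] Fl[of "Suc j"] that
        by (intro exI[of _ "F j"] exI[of _ "F (Suc j)"]) simp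
      show "before q (Q i) (Q (Suc i))" "before q (Q (Suc i)) (Q (Suc (Suc i)))"
        using bfs k(2) by auto
    qed
    show "\<not> interval_cond i (k - i) q"
    proof
      assume "interval_cond i (k - i) q"
      then have 5: "Q i < Q (Suc i)" "Q (Suc i) < Q (Suc (Suc i))"
        using 1 2 3 4 unfolding interval_cond_def by blast+
      have "Q a < Q b" if "a < b" "b \<le> Suc (Suc k)" for a b
      proof -
        have "Q j < Q (Suc j)" if "j < Suc (Suc k)" for j
          using 5 Qs[of j "Suc j"] that by (cases "j = i \<or> j = Suc i") auto
        then show ?thesis
          using skip_mono[of "Suc (Suc k)" "Suc (Suc (Suc k))" Q a b] that by auto
      qed
      then have "\<forall>a b. a < b \<longrightarrow> b \<le> k \<longrightarrow> p ! f a < p ! f b"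
        by (metis Qm Suc_le_mono Suc_mono le_SucI less_imp_le order_trans)
      then show False using nsrt by simp
    qed
  next
    assume "\<not> interval_cond i (k - i) q"
    then obtain x y z where xyz: "lchain q i x" "uchain q (k - i) y" "x < y" "before q x z" "before q z y"
      "\<not> (x < z \<and> z < y)" "i = 0 \<Longrightarrow> x = 0" "k - i = 0 \<Longrightarrow> y = n + 1"
      using interval_violation[of i "k - i"] k by auto
    obtain c d where cd: "c < d" "d < length q" "q ! c = x" "q ! d = z"
      using xyz(4) unfolding before_conv_nth by blast
    obtain d' e where de: "d' < e" "e < length q" "q ! d' = z" "q ! e = y"
      using xyz(5) unfolding before_conv_nth by blast
    have "d' = d" using nth_eq_iff_index_eq[OF dq, of d' d] cd de by linarith
    then have e: "d < e" "e < length q" "q ! e = y" using de by blast+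
    obtain F1 where F1: "F1 i = c" "\<forall>j<i. F1 j < F1 (Suc j) \<and> q ! F1 j < q ! F1 (Suc j)"
      using lchain_chain[OF dq, of i c] xyz cd by auto
    obtain F2 where F2: "F2 0 = e" "F2 (k - i) < length q"
      "\<forall>j<k - i. F2 j < F2 (Suc j) \<and> q ! F2 j < q ! F2 (Suc j)"
      using uchain_chain[OF dq, of "k - i" e] xyz e by auto
    \<comment> \<open>The chain to \<open>x\<close> occupies the indices up to \<open>i\<close>, the
      entry \<open>z\<close> has index \<open>Suc i\<close>, and the chain from \<open>y\<close>
      begins at \<open>Suc (Suc i)\<close>.\<close>
    define F where "F j = (if j \<le> i then F1 j else if j = Suc i then d else F2 (j - Suc (Suc i)))" for j
    define Q where "Q j = q ! F j" for j
    have F2s: "F2 (j - Suc (Suc i)) < F2 (Suc j - Suc (Suc i)) \<and>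
        q ! F2 (j - Suc (Suc i)) < q ! F2 (Suc j - Suc (Suc i))"
      if "Suc (Suc i) \<le> j" "j \<le> Suc k" for j
    proof -
      have lt: "j - Suc (Suc i) < k - i" and eq: "Suc j - Suc (Suc i) = Suc (j - Suc (Suc i))"
        using that by linarith+
      show ?thesis unfolding eq by (rule F2(3)[rule_format, OF lt])
    qed
    have Fm: "F j < F (Suc j)" if "j \<le> Suc k" for j
    proof -
      consider "j < i" | "j = i" | "j = Suc i" | "Suc (Suc i) \<le> j" by linarith
      then show ?thesis
        using F1 F2(1) F2s[of j] cd e that by cases (auto simp: F_def)
    qed
    have Qstep: "Q j < Q (Suc j)" if j: "j < Suc (Suc k)" "j \<noteq> Suc i" "Suc j \<noteq> Suc i" for j
    proof -
      consider "j < i" | "Suc (Suc i) \<le> j" using j by linarith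
      then show ?thesis using F1 F2s[of j] j by cases (auto simp: F_def Q_def)
    qed
    have Qi: "Q i = x" "Q (Suc i) = z" "Q (Suc (Suc i)) = y"
      using F1 F2 cd e by (auto simp: Q_def F_def)
    have Qs: "Q a < Q b" if "a < b" "b \<le> Suc (Suc k)" "a \<noteq> Suc i" "b \<noteq> Suc i" for a b
      using skip_mono[of "Suc (Suc k)" "Suc i" Q a b] Qstep Qi xyz(3) that by auto
    have Fmono: "F a < F b" if "a < b" "b \<le> Suc (Suc k)" for a b
      using skip_mono[of "Suc (Suc k)" "Suc (Suc (Suc k))" F a b] Fm that by auto
    have Fl: "F (Suc (Suc k)) < length q" using F2 k by (simp add: F_def)
    have rng: "0 < F (Suc j) \<and> F (Suc j) \<le> n" if "j \<le> k" for j
      using Fmono[of 0 "Suc j"] Fmono[of "Suc j" "Suc (Suc k)"] Fl lq that by auto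
    \<comment> \<open>The two outermost positions are dropped, even if they are not the frame
      positions. Strict monotonicity keeps the remaining ones inside \<open>p\<close>; subtracting
      one removes the offset of the frame.\<close>
    define f where "f j = F (Suc j) - 1" for j
    have Qf: "Q (Suc j) = p ! f j" if "j \<le> k" for j
    proof -
      have "f j < n" "F (Suc j) = Suc (f j)" using rng[OF that] by (auto simp: f_def)
      then show ?thesis using frame_nth(1)[of "f j"] by (simp add: Q_def)
    qed
    have pr: "1 \<le> p ! f j \<and> p ! f j \<le> n" if "j \<le> k" for j
    proof -
      have "f j < n" using rng[OF that] by (auto simp: f_def)
      then show ?thesis using nth_mem[of "f j" p] len permsD[OF p] by auto
    qed
    \<comment> \<open>If \<open>i = 0\<close>, the entry \<open>x\<close> is dropped from the
      selection, so \<open>x < z\<close> rests on \<open>x = 0\<close>. If \<open>i = k\<close>, the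
      same happens to \<open>y\<close>, and \<open>z < y\<close> rests on
      \<open>y = n + 1\<close>.\<close>
    have nall: "\<not> (\<forall>a b. a < b \<longrightarrow> b \<le> k \<longrightarrow> p ! f a < p ! f b)"
    proof
      assume all: "\<forall>a b. a < b \<longrightarrow> b \<le> k \<longrightarrow> p ! f a < p ! f b"
      have "x < z"
      proof (cases i)
        case 0
        then show ?thesis using xyz(7) Qi Qf[of i] pr[of i] k by auto
      next
        case (Suc j)
        then have "p ! f j < p ! f i" using all k by simp
        then show ?thesis using Qf[of j] Qf[of i] Suc k Qi by simp
      qed
      moreover have "z < y"
      proof (cases "i = k")
        case True
        then show ?thesis using xyz(8) Qi Qf[of i] pr[of i] k by auto
      next
        case False
        then have "p ! f i < p ! f (Suc i)" using all k by simp
        then show ?thesis using Qf[of "Suc i"] Qf[of i] False k Qi by simp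
      qed
      ultimately show False using xyz by simp
    qed
    have "strict_mono_on {..k} f"
    proof (rule strict_mono_onI)
      fix a b assume "a \<in> {..k}" "b \<in> {..k}" "a < b"
      then show "f a < f b" using Fmono[of "Suc a" "Suc b"] rng[of a] by (auto simp: f_def)
    qed
    moreover have "f ` {..k} \<subseteq> {..<length p}" using rng len by (force simp: f_def)
    moreover have "\<forall>a b. a < b \<longrightarrow> b \<le> k \<longrightarrow> a \<noteq> i \<longrightarrow> b \<noteq> i \<longrightarrow> p ! f a < p ! f b"
    proof (intro allI impI)
      fix a b assume "a < b" "b \<le> k" "a \<noteq> i" "b \<noteq> i"
      then show "p ! f a < p ! f b" using Qs[of "Suc a" "Suc b"] Qf[of a] Qf[of b] by simp
    qed
    ultimately show "\<exists>f. strict_mono_on {..k} f \<and> f ` {..k} \<subseteq> {..<length p} \<and>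
      (\<forall>a b. a < b \<longrightarrow> b \<le> k \<longrightarrow> a \<noteq> i \<longrightarrow> b \<noteq> i \<longrightarrow> p ! f a < p ! f b) \<and>
      \<not> (\<forall>a b. a < b \<longrightarrow> b \<le> k \<longrightarrow> p ! f a < p ! f b)"
      using nall by blast
  qed
qed

end

section \<open>Wilf-equivalence\<close>

lemma framed_perms_conv_perms:
  "{q. distinct q \<and> set q = {..n + 1} \<and> framed (n + 1) q} = (\<lambda>p. 0 # p @ [n + 1]) ` perms n"
proof (intro set_eqI iffI)
  fix q assume "q \<in> {q. distinct q \<and> set q = {..n + 1} \<and> framed (n + 1) q}"
  then have q: "distinct q" "set q = {..n + 1}" "q \<noteq> []" "hd q = 0" "last q = n + 1"
    by (auto simp: framed_def)
  then obtain q' where q': "q = 0 # q'" by (cases q) auto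
  then have "q' \<noteq> []" using q by auto
  then obtain p where p: "q = 0 # p @ [n + 1]" using q q' by (cases q' rule: rev_cases) auto
  have "set p = set q - {0, n + 1}" using q(1) unfolding p by auto
  also have "\<dots> = {1..n}" unfolding q(2) by auto
  finally have "set p = {1..n}" .
  moreover have "distinct p" using q(1) unfolding p by simp
  ultimately have "p \<in> perms n" by (simp add: perms_def permutations_of_set_def)
  then show "q \<in> (\<lambda>p. 0 # p @ [n + 1]) ` perms n" using p by blast
next
  fix q assume "q \<in> (\<lambda>p. 0 # p @ [n + 1]) ` perms n"
  then obtain p where p: "p \<in> perms n" "q = 0 # p @ [n + 1]" by blast
  then show "q \<in> {q. distinct q \<and> set q = {..n + 1} \<and> framed (n + 1) q}"
    using frame_props[OF p(1)] by (simp add: framed_def del: set_append set_simps)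
qed

lemma filter_image:
  assumes "\<And>x. x \<in> A \<Longrightarrow> P (g x) \<longleftrightarrow> R x"
  shows "{y \<in> g ` A. P y} = g ` {x \<in> A. R x}"
  using assms by auto

lemma card_Av_M:
  assumes "1 \<le> k" "i \<le> k"
  shows "card (Av n (M k (i + 1) (i + 1))) = card (framed_perms i (k - i) (n + 1))"
proof -
  let ?g = "\<lambda>p. 0 # p @ [n + 1]"
  have "framed_perms i (k - i) (n + 1) = {q \<in> ?g ` perms n. interval_cond i (k - i) q}"
    unfolding framed_perms_conv_perms[symmetric] framed_perms_def interval_perms_def by blast
  also have "\<dots> = ?g ` {p \<in> perms n. \<forall>r\<in>M k (i + 1) (i + 1). \<not> contains p r}"
    by (rule filter_image) (use contains_M_iff_violation[OF _ assms] in blast)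
  also have "{p \<in> perms n. \<forall>r\<in>M k (i + 1) (i + 1). \<not> contains p r} = Av n (M k (i + 1) (i + 1))"
    by (simp only: Av_def)
  finally have "framed_perms i (k - i) (n + 1) = ?g ` Av n (M k (i + 1) (i + 1))" .
  moreover have "inj_on ?g A" for A by (rule inj_onI) simp
  ultimately show ?thesis by (simp only: card_image)
qed

theorem theorem2p2:
  fixes k i i' :: nat
  assumes "k \<ge> 1" and "i \<le> k" and "i' \<le> k"
  shows "wilf_equivalent (M k (i + 1) (i + 1)) (M k (i' + 1) (i' + 1))"
proof -
  have "card (Av n (M k (j + 1) (j + 1))) = card (framed_perms 0 k (n + 1))" if "j \<le> k" for j n
    using card_Av_M[OF assms(1) that] card_framed_perms[OF that] by metis
  then show ?thesis using assms(2,3) unfolding wilf_equivalent_def by metis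
qed

end
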